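(* Let $\mathbb{K}$ be an algebraically closed field. For every $p\in\mathbb{P}^1(\mathbb{K})$ let $m^p,n^p\ge0$ be integers, only finitely many of them nonzero, and let $b^p_1\ge b^p_2\ge\dots\ge b^p_{m^p}$ and $e^p_1\ge e^p_2\ge\dots\ge e^p_{n^p}$ be positive integers. Consider the regular Kronecker representations $$M^R=\bigoplus_{p\in\mathbb{P}^1(\mathbb{K})}\bigoplus_{i=1}^{m^p}R_{p,b^p_i},\qquad N^R=\bigoplus_{p\in\mathbb{P}^1(\mathbb{K})}\bigoplus_{i=1}^{n^p}R_{p,e^p_i}.$$ Then $N^R$ is a subrepresentation of $M^R$ if and only if, for every $p\in\mathbb{P}^1(\mathbb{K})$, $m^p\ge n^p$ and $b^p_i\ge e^p_i$ for all $1\le i\le n^p$.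
   Context: A Kronecker representation $(V,W;f,g)$ consists of finite-dimensional $\mathbb{K}$-vector spaces $V,W$ and linear maps $f,g:V\to W$. The superscripts $p$ are indices, not powers. $\mathbb{P}^1(\mathbb{K})=\mathbb{K}\cup\{\infty\}$ is the projective line. For $i\ge1$, with $I$ the $i\times i$ identity matrix and $J$ the $i\times i$ (upper triangular) Jordan block with eigenvalue $0$, $R_{\infty,i}=(\mathbb{K}^i,\mathbb{K}^i;J,I)$ and $R_{p,i}=(\mathbb{K}^i,\mathbb{K}^i;I,pI+J)$ for $p\in\mathbb{K}$. Direct sums are taken componentwise. Subrepresentations are considered up to isomorphism: $(V',W';f',g')$ is a subrepresentation of $(V,W;f,g)$ if there are injective linear maps $\phi:V'\to V$ and $\psi:W'\to W$ with $f\phi=\psi f'$ and $g\phi=\psi g'$. *)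

theory Defs
  imports
    "Jordan_Normal_Form.VS_Connect"
    "Jordan_Normal_Form.Jordan_Normal_Form"
    "HOL-Computational_Algebra.Polynomial"
begin

text \<open>These would otherwise hide the record fields of \<^type>\<open>module_ext\<close>.\<close>

hide_const (open) Multiset.mult Polynomial.smult

text \<open>
  Vector spaces over a field given by a type class are vector spaces, in the sense of the
  locale \<^locale>\<open>vectorspace\<close>, over the ring record \<^term>\<open>class_ring\<close>.
\<close>

record ('k, 'v, 'w) kronecker =
  dom_space :: "('k, 'v) module"
  cod_space :: "('k, 'w) module"
  map_f :: "'v \<Rightarrow> 'w"
  map_g :: "'v \<Rightarrow> 'w"

definition kronecker_rep :: "('k::field, 'v, 'w) kronecker \<Rightarrow> bool" where
  "kronecker_rep M \<longleftrightarrow>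
     linear_map class_ring (dom_space M) (cod_space M) (map_f M) \<and>
     linear_map class_ring (dom_space M) (cod_space M) (map_g M) \<and>
     vectorspace.fin_dim class_ring (dom_space M) \<and>
     vectorspace.fin_dim class_ring (cod_space M)"

definition subrep ::
    "('k::field, 'v1, 'w1) kronecker \<Rightarrow> ('k, 'v2, 'w2) kronecker \<Rightarrow> bool" where
  "subrep N M \<longleftrightarrow> kronecker_rep N \<and> kronecker_rep M \<and>
     (\<exists>\<phi> \<psi>.
        linear_map class_ring (dom_space N) (dom_space M) \<phi> \<and>
        linear_map class_ring (cod_space N) (cod_space M) \<psi> \<and>
        inj_on \<phi> (carrier (dom_space N)) \<and>
        inj_on \<psi> (carrier (cod_space N)) \<and>
        (\<forall>v\<in>carrier (dom_space N). map_f M (\<phi> v) = \<psi> (map_f N v)) \<and>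
        (\<forall>v\<in>carrier (dom_space N). map_g M (\<phi> v) = \<psi> (map_g N v)))"

text \<open>
  The external direct sum of a family of modules: its elements are the extensional
  functions with finitely many nonzero components.  The ring multiplication and unit contained in
  a \<^type>\<open>module_ext\<close> record carry no meaning.  Extensionality makes equality of functions
  agree with equality on \<open>I\<close>.
\<close>

definition module_sum :: "'i set \<Rightarrow> ('i \<Rightarrow> ('k, 'v) module) \<Rightarrow> ('k, 'i \<Rightarrow> 'v) module" where
  "module_sum I V = \<lparr>
     carrier = {x \<in> \<Pi>\<^sub>E i\<in>I. carrier (V i). finite {i \<in> I. x i \<noteq> \<zero>\<^bsub>V i\<^esub>}},
     mult = undefined,
     one = undefined,
     zero = (\<lambda>i\<in>I. \<zero>\<^bsub>V i\<^esub>),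
     add = (\<lambda>x y. \<lambda>i\<in>I. x i \<oplus>\<^bsub>V i\<^esub> y i),
     smult = (\<lambda>c x. \<lambda>i\<in>I. c \<odot>\<^bsub>V i\<^esub> x i)\<rparr>"

definition kronecker_sum ::
    "'i set \<Rightarrow> ('i \<Rightarrow> ('k, 'v, 'w) kronecker) \<Rightarrow> ('k, 'i \<Rightarrow> 'v, 'i \<Rightarrow> 'w) kronecker" where
  "kronecker_sum I M = \<lparr>
     dom_space = module_sum I (\<lambda>i. dom_space (M i)),
     cod_space = module_sum I (\<lambda>i. cod_space (M i)),
     map_f = (\<lambda>x. \<lambda>i\<in>I. map_f (M i) (x i)),
     map_g = (\<lambda>x. \<lambda>i\<in>I. map_g (M i) (x i))\<rparr>"

datatype 'k proj_line = Finite 'k | Infinity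

definition matrix_rep :: "nat \<Rightarrow> 'k::field mat \<Rightarrow> 'k mat \<Rightarrow> ('k, 'k vec, 'k vec) kronecker" where
  "matrix_rep n A B = \<lparr>
     dom_space = module_vec TYPE('k) n,
     cod_space = module_vec TYPE('k) n,
     map_f = (\<lambda>v. A *\<^sub>v v),
     map_g = (\<lambda>v. B *\<^sub>v v)\<rparr>"

text \<open>
  \<^term>\<open>jordan_block n a\<close> is upper triangular: \<open>a\<close> on the diagonal, \<open>1\<close> just above it.
\<close>

fun R_rep :: "'k::field proj_line \<Rightarrow> nat \<Rightarrow> ('k, 'k vec, 'k vec) kronecker" where
  "R_rep Infinity n = matrix_rep n (jordan_block n 0) (1\<^sub>m n)"
| "R_rep (Finite p) n = matrix_rep n (1\<^sub>m n) (p \<cdot>\<^sub>m 1\<^sub>m n + jordan_block n 0)"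

text \<open>
  \<^term>\<open>m p\<close> is the number of summands at the point \<open>p\<close>, and only the values \<^term>\<open>b p i\<close> with
  \<open>1 \<le> i \<le> m p\<close> are used.  For finitely supported \<open>m\<close> the result is finite-dimensional.
\<close>

definition regular_rep ::
    "('k::field proj_line \<Rightarrow> nat) \<Rightarrow> ('k proj_line \<Rightarrow> nat \<Rightarrow> nat) \<Rightarrow>
     ('k, 'k proj_line \<Rightarrow> nat \<Rightarrow> 'k vec, 'k proj_line \<Rightarrow> nat \<Rightarrow> 'k vec) kronecker" where
  "regular_rep m b = kronecker_sum UNIV (\<lambda>p. kronecker_sum {1..m p} (\<lambda>i. R_rep p (b p i)))"


subsection \<open>The constructions yield Kronecker representations\<close>

lemma vectorspace_class_ringI:
  fixes V :: "('k::field, 'v) module"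
  assumes "abelian_group V"
    and "\<And>a x. x \<in> carrier V \<Longrightarrow> a \<odot>\<^bsub>V\<^esub> x \<in> carrier V"
    and "\<And>a b x. x \<in> carrier V \<Longrightarrow> (a + b) \<odot>\<^bsub>V\<^esub> x = a \<odot>\<^bsub>V\<^esub> x \<oplus>\<^bsub>V\<^esub> b \<odot>\<^bsub>V\<^esub> x"
    and "\<And>a x y. x \<in> carrier V \<Longrightarrow> y \<in> carrier V \<Longrightarrow>
           a \<odot>\<^bsub>V\<^esub> (x \<oplus>\<^bsub>V\<^esub> y) = a \<odot>\<^bsub>V\<^esub> x \<oplus>\<^bsub>V\<^esub> a \<odot>\<^bsub>V\<^esub> y"
    and "\<And>a b x. x \<in> carrier V \<Longrightarrow> (a * b) \<odot>\<^bsub>V\<^esub> x = a \<odot>\<^bsub>V\<^esub> (b \<odot>\<^bsub>V\<^esub> x)"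
    and "\<And>x. x \<in> carrier V \<Longrightarrow> 1 \<odot>\<^bsub>V\<^esub> x = x"
  shows "vectorspace class_ring V"
proof -
  have F: "field (class_ring :: 'k ring)"
    by (rule class_field)
  from F have C: "cring (class_ring :: 'k ring)"
    by (simp add: field_def domain_def)
  have "Module.module class_ring V"
    by (rule moduleI[OF C]) (use assms in auto)
  then show ?thesis
    using F by (simp add: vectorspace_def)
qed

lemma vectorspace_module_sum:
  fixes V :: "'i \<Rightarrow> ('k::field, 'v) module"
  assumes V: "\<And>i. i \<in> I \<Longrightarrow> vectorspace class_ring (V i)"
  shows "vectorspace class_ring (module_sum I V)"
proof -
  have M: "Module.module class_ring (V i)" if "i \<in> I" for i
    using V[OF that] by (simp add: vectorspace_def)
  have A: "abelian_group (V i)" if "i \<in> I" for i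
    using M[OF that] by (simp add: Module.module_def)
  have AM: "abelian_monoid (V i)" if "i \<in> I" for i
    using A[OF that] by (simp add: abelian_group_def)
  note [simp] = abelian_monoid.a_closed[OF AM] abelian_monoid.zero_closed[OF AM]
    abelian_monoid.l_zero[OF AM] abelian_group.a_inv_closed[OF A] abelian_group.l_neg[OF A]
    module.smult_closed[OF M, simplified] module.smult_r_null[OF M, simplified]
  have fin: "finite {i \<in> I. x i \<oplus>\<^bsub>V i\<^esub> y i \<noteq> \<zero>\<^bsub>V i\<^esub>}"
    if "finite {i \<in> I. x i \<noteq> \<zero>\<^bsub>V i\<^esub>}" "finite {i \<in> I. y i \<noteq> \<zero>\<^bsub>V i\<^esub>}" for x y
    by (rule finite_subset[OF _ finite_UnI[OF that]]) auto
  have fin': "finite {i \<in> I. c \<odot>\<^bsub>V i\<^esub> x i \<noteq> \<zero>\<^bsub>V i\<^esub>}"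
    if "finite {i \<in> I. x i \<noteq> \<zero>\<^bsub>V i\<^esub>}" for x c
    by (rule finite_subset[OF _ that]) auto
  show ?thesis
  proof (rule vectorspace_class_ringI)
    show "abelian_group (module_sum I V)"
    proof (rule abelian_groupI)
      fix x y assume "x \<in> carrier (module_sum I V)" "y \<in> carrier (module_sum I V)"
      then show "x \<oplus>\<^bsub>module_sum I V\<^esub> y \<in> carrier (module_sum I V)"
        using fin[of x y] by (auto simp: module_sum_def PiE_iff cong: conj_cong)
    next
      show "\<zero>\<^bsub>module_sum I V\<^esub> \<in> carrier (module_sum I V)"
        by (auto simp: module_sum_def cong: conj_cong)
    next
      fix x y z assume "x \<in> carrier (module_sum I V)" "y \<in> carrier (module_sum I V)"
        "z \<in> carrier (module_sum I V)"
      then show "x \<oplus>\<^bsub>module_sum I V\<^esub> y \<oplus>\<^bsub>module_sum I V\<^esub> z =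
          x \<oplus>\<^bsub>module_sum I V\<^esub> (y \<oplus>\<^bsub>module_sum I V\<^esub> z)"
        by (auto simp: module_sum_def PiE_iff intro!: restrict_ext abelian_monoid.a_assoc[OF AM])
    next
      fix x y assume "x \<in> carrier (module_sum I V)" "y \<in> carrier (module_sum I V)"
      then show "x \<oplus>\<^bsub>module_sum I V\<^esub> y = y \<oplus>\<^bsub>module_sum I V\<^esub> x"
        by (auto simp: module_sum_def PiE_iff intro!: restrict_ext abelian_monoid.a_comm[OF AM])
    next
      fix x assume "x \<in> carrier (module_sum I V)"
      then show "\<zero>\<^bsub>module_sum I V\<^esub> \<oplus>\<^bsub>module_sum I V\<^esub> x = x"
        by (auto simp: module_sum_def PiE_iff extensional_def fun_eq_iff)
    next
      fix x assume x: "x \<in> carrier (module_sum I V)"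
      define y where "y = (\<lambda>i\<in>I. \<ominus>\<^bsub>V i\<^esub> x i)"
      have "finite {i \<in> I. y i \<noteq> \<zero>\<^bsub>V i\<^esub>}"
      proof (rule finite_subset)
        show "{i \<in> I. y i \<noteq> \<zero>\<^bsub>V i\<^esub>} \<subseteq> {i \<in> I. x i \<noteq> \<zero>\<^bsub>V i\<^esub>}"
          by (auto simp: y_def abelian_group.minus_equality[OF A])
      qed (use x in \<open>simp add: module_sum_def\<close>)
      then have "y \<in> carrier (module_sum I V)"
        using x by (auto simp: module_sum_def PiE_iff y_def)
      moreover have "y \<oplus>\<^bsub>module_sum I V\<^esub> x = \<zero>\<^bsub>module_sum I V\<^esub>"
        using x by (auto simp: module_sum_def PiE_iff y_def intro!: restrict_ext)
      ultimately show "\<exists>y\<in>carrier (module_sum I V).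
          y \<oplus>\<^bsub>module_sum I V\<^esub> x = \<zero>\<^bsub>module_sum I V\<^esub>"
        by blast
    qed
  next
    fix a x assume "x \<in> carrier (module_sum I V)"
    then show "a \<odot>\<^bsub>module_sum I V\<^esub> x \<in> carrier (module_sum I V)"
      using fin'[of x a] by (auto simp: module_sum_def PiE_iff cong: conj_cong)
  next
    fix a b x assume "x \<in> carrier (module_sum I V)"
    then show "(a + b) \<odot>\<^bsub>module_sum I V\<^esub> x =
        a \<odot>\<^bsub>module_sum I V\<^esub> x \<oplus>\<^bsub>module_sum I V\<^esub> b \<odot>\<^bsub>module_sum I V\<^esub> x"
      using module.smult_l_distr[OF M]
      by (auto simp: module_sum_def PiE_iff intro!: restrict_ext)
  next
    fix a x y assume "x \<in> carrier (module_sum I V)" "y \<in> carrier (module_sum I V)"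
    then show "a \<odot>\<^bsub>module_sum I V\<^esub> (x \<oplus>\<^bsub>module_sum I V\<^esub> y) =
        a \<odot>\<^bsub>module_sum I V\<^esub> x \<oplus>\<^bsub>module_sum I V\<^esub> a \<odot>\<^bsub>module_sum I V\<^esub> y"
      using module.smult_r_distr[OF M]
      by (auto simp: module_sum_def PiE_iff intro!: restrict_ext)
  next
    fix a b x assume "x \<in> carrier (module_sum I V)"
    then show "(a * b) \<odot>\<^bsub>module_sum I V\<^esub> x =
        a \<odot>\<^bsub>module_sum I V\<^esub> (b \<odot>\<^bsub>module_sum I V\<^esub> x)"
      using module.smult_assoc1[OF M]
      by (auto simp: module_sum_def PiE_iff intro!: restrict_ext)
  next
    fix x assume "x \<in> carrier (module_sum I V)"
    then show "1 \<odot>\<^bsub>module_sum I V\<^esub> x = x"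
      using module.smult_one[OF M]
      by (auto simp: module_sum_def PiE_iff extensional_def fun_eq_iff)
  qed
qed

lemma fin_dim_module_sum:
  fixes V :: "'i \<Rightarrow> ('k::field, 'v) module"
  assumes V: "\<And>i. i \<in> I \<Longrightarrow> vectorspace class_ring (V i)"
    and fd: "\<And>i. i \<in> I \<Longrightarrow> vectorspace.fin_dim class_ring (V i)"
    and J: "finite {i \<in> I. carrier (V i) \<noteq> {\<zero>\<^bsub>V i\<^esub>}}"
  shows "vectorspace.fin_dim class_ring (module_sum I V)"
proof -
  interpret S: vectorspace class_ring "module_sum I V"
    by (rule vectorspace_module_sum[OF V])
  have M: "Module.module class_ring (V i)" if "i \<in> I" for i
    using V[OF that] by (simp add: vectorspace_def)
  have AM: "abelian_monoid (V i)" if "i \<in> I" for i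
    using M[OF that] by (simp add: Module.module_def abelian_group_def)
  note [simp] = abelian_monoid.a_closed[OF AM] abelian_monoid.zero_closed[OF AM]
    abelian_monoid.l_zero[OF AM] abelian_monoid.r_zero[OF AM]
    module.smult_closed[OF M, simplified] module.smult_r_null[OF M, simplified]
  define inj where "inj i v = (\<lambda>j\<in>I. if j = i then v else \<zero>\<^bsub>V j\<^esub>)" for i and v :: 'v
  have inj_carrier: "inj i v \<in> carrier (module_sum I V)" if "i \<in> I" "v \<in> carrier (V i)" for i v
    using that by (auto simp: module_sum_def inj_def intro: finite_subset[of _ "{i}"])
  have "\<exists>A. finite A \<and> A \<subseteq> carrier (V i) \<and> LinearCombinations.module.span class_ring (V i) A = carrier (V i)"
    if "i \<in> I" for i
    using fd[OF that] by (simp add: vectorspace.fin_dim_def[OF V[OF that]])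
  then obtain A where A: "\<And>i. i \<in> I \<Longrightarrow> finite (A i)" "\<And>i. i \<in> I \<Longrightarrow> A i \<subseteq> carrier (V i)"
      "\<And>i. i \<in> I \<Longrightarrow> LinearCombinations.module.span class_ring (V i) (A i) = carrier (V i)"
    by metis
  define J' where "J' = {i \<in> I. carrier (V i) \<noteq> {\<zero>\<^bsub>V i\<^esub>}}"
  define B where "B = (\<Union>i\<in>J'. inj i ` A i)"
  have finB: "finite B"
    using J A(1) by (auto simp: B_def J'_def)
  have BC: "B \<subseteq> carrier (module_sum I V)"
    using A(2) inj_carrier by (fastforce simp: B_def J'_def)
  have sub: "submodule class_ring (S.span B) (module_sum I V)"
    by (rule S.span_is_submodule[OF BC])
  have inj_span: "inj i v \<in> S.span B" if i: "i \<in> J'" and v: "v \<in> carrier (V i)" for i v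
  proof -
    have iI: "i \<in> I"
      using i by (simp add: J'_def)
    define N where "N = {v \<in> carrier (V i). inj i v \<in> S.span B}"
    have "submodule class_ring N (V i)"
    proof (rule submodule.intro)
      show "Module.module class_ring (V i)" by (rule M[OF iI])
    next
      show "N \<subseteq> carrier (V i)" by (auto simp: N_def)
    next
      fix v w assume vw: "v \<in> N" "w \<in> N"
      have "inj i (v \<oplus>\<^bsub>V i\<^esub> w) = inj i v \<oplus>\<^bsub>module_sum I V\<^esub> inj i w"
        by (auto simp: module_sum_def inj_def intro!: restrict_ext)
      then show "v \<oplus>\<^bsub>V i\<^esub> w \<in> N"
        using vw iI submodule.m_closed[OF sub] by (auto simp: N_def)
    next
      have "inj i \<zero>\<^bsub>V i\<^esub> = \<zero>\<^bsub>module_sum I V\<^esub>"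
        by (auto simp: module_sum_def inj_def intro!: restrict_ext)
      then show "\<zero>\<^bsub>V i\<^esub> \<in> N"
        using iI submodule.zero_closed[OF sub] by (auto simp: N_def)
    next
      fix c :: 'k and v assume v: "v \<in> N"
      have "inj i (c \<odot>\<^bsub>V i\<^esub> v) = c \<odot>\<^bsub>module_sum I V\<^esub> inj i v"
        by (auto simp: module_sum_def inj_def intro!: restrict_ext)
      then show "c \<odot>\<^bsub>V i\<^esub> v \<in> N"
        using v iI submodule.smult_closed[OF sub] by (auto simp: N_def)
    qed
    moreover have "A i \<subseteq> N"
    proof
      fix a assume a: "a \<in> A i"
      then have "inj i a \<in> B"
        using i by (auto simp: B_def)
      then show "a \<in> N"
        using a A(2)[OF iI] S.in_own_span[OF BC] by (auto simp: N_def)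
    qed
    ultimately have "LinearCombinations.module.span class_ring (V i) (A i) \<subseteq> N"
      by (intro LinearCombinations.module.span_is_subset[OF M[OF iI]])
    then show ?thesis
      using v A(3)[OF iI] by (auto simp: N_def)
  qed
  have "x \<in> S.span B"
    if "finite K" "K \<subseteq> J'" "x \<in> carrier (module_sum I V)" "\<And>i. i \<in> I - K \<Longrightarrow> x i = \<zero>\<^bsub>V i\<^esub>"
    for x K
    using that
  proof (induction K arbitrary: x rule: finite_induct)
    case empty
    then have "x = \<zero>\<^bsub>module_sum I V\<^esub>"
      by (auto simp: module_sum_def PiE_iff extensional_def fun_eq_iff)
    then show ?case
      using submodule.zero_closed[OF sub] by simp
  next
    case (insert k K)
    have kI: "k \<in> I"
      using insert.prems(1) by (auto simp: J'_def)
    define y where "y = (\<lambda>i\<in>I. if i = k then \<zero>\<^bsub>V i\<^esub> else x i)"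
    have "finite {i \<in> I. y i \<noteq> \<zero>\<^bsub>V i\<^esub>}"
      by (rule finite_subset[of _ "{i \<in> I. x i \<noteq> \<zero>\<^bsub>V i\<^esub>}"])
        (use insert.prems(2) in \<open>auto simp: y_def module_sum_def split: if_splits\<close>)
    then have y: "y \<in> carrier (module_sum I V)"
      using insert.prems(2) by (auto simp: module_sum_def PiE_iff y_def)
    have "y \<in> S.span B"
    proof (rule insert.IH)
      show "y i = \<zero>\<^bsub>V i\<^esub>" if "i \<in> I - K" for i
        using that insert.prems(3)[of i] by (auto simp: y_def)
    qed (use insert.prems y in auto)
    moreover have "x k \<in> carrier (V k)"
      using insert.prems(2) kI by (auto simp: module_sum_def)
    then have "inj k (x k) \<in> S.span B"
      using insert.prems(1) by (intro inj_span) auto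
    moreover have "x = inj k (x k) \<oplus>\<^bsub>module_sum I V\<^esub> y"
      using insert.prems(2) kI
      by (auto simp: module_sum_def PiE_iff extensional_def inj_def y_def fun_eq_iff)
    ultimately show ?case
      using submodule.m_closed[OF sub] by metis
  qed
  moreover have "x i = \<zero>\<^bsub>V i\<^esub>" if "x \<in> carrier (module_sum I V)" "i \<in> I - J'" for x i
    using that by (auto simp: module_sum_def J'_def PiE_iff)
  ultimately have "carrier (module_sum I V) \<subseteq> S.span B"
    using J unfolding J'_def by blast
  then have "S.span B = carrier (module_sum I V)"
    using S.span_is_subset2[OF BC] by blast
  then show ?thesis
    unfolding S.fin_dim_def using finB BC by blast
qed

lemma linear_mapI:
  fixes V :: "('k::field, 'v) module" and W :: "('k, 'w) module"
  assumes "vectorspace class_ring V" "vectorspace class_ring W"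
    and "\<And>x. x \<in> carrier V \<Longrightarrow> h x \<in> carrier W"
    and "\<And>x y. x \<in> carrier V \<Longrightarrow> y \<in> carrier V \<Longrightarrow> h (x \<oplus>\<^bsub>V\<^esub> y) = h x \<oplus>\<^bsub>W\<^esub> h y"
    and "\<And>c x. x \<in> carrier V \<Longrightarrow> h (c \<odot>\<^bsub>V\<^esub> x) = c \<odot>\<^bsub>W\<^esub> h x"
  shows "linear_map class_ring V W h"
  using assms
  by (simp add: linear_map_def mod_hom_def mod_hom_axioms_def LinearCombinations.module_hom_def
      vectorspace_def)

lemma linear_map_module_sum:
  fixes V :: "'i \<Rightarrow> ('k::field, 'v) module" and W :: "'i \<Rightarrow> ('k, 'w) module"
  assumes h: "\<And>i. i \<in> I \<Longrightarrow> linear_map class_ring (V i) (W i) (h i)"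
  shows "linear_map class_ring (module_sum I V) (module_sum I W) (\<lambda>x. \<lambda>i\<in>I. h i (x i))"
proof -
  have V: "vectorspace class_ring (V i)" and W: "vectorspace class_ring (W i)"
    and H: "mod_hom class_ring (V i) (W i) (h i)" if "i \<in> I" for i
    using h[OF that] by (simp_all add: linear_map_def)
  note [simp] = mod_hom.f_im[OF H] mod_hom.f0_is_0[OF H]
  show ?thesis
  proof (rule linear_mapI)
    fix x assume x: "x \<in> carrier (module_sum I V)"
    then have "finite {i \<in> I. h i (x i) \<noteq> \<zero>\<^bsub>W i\<^esub>}"
      by (intro finite_subset[of "{i \<in> I. h i (x i) \<noteq> \<zero>\<^bsub>W i\<^esub>}"
            "{i \<in> I. x i \<noteq> \<zero>\<^bsub>V i\<^esub>}"]) (auto simp: module_sum_def)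
    then show "(\<lambda>i\<in>I. h i (x i)) \<in> carrier (module_sum I W)"
      using x by (auto simp: module_sum_def PiE_iff cong: conj_cong)
  next
    fix x y assume "x \<in> carrier (module_sum I V)" "y \<in> carrier (module_sum I V)"
    then show "(\<lambda>i\<in>I. h i ((x \<oplus>\<^bsub>module_sum I V\<^esub> y) i)) =
        (\<lambda>i\<in>I. h i (x i)) \<oplus>\<^bsub>module_sum I W\<^esub> (\<lambda>i\<in>I. h i (y i))"
      by (auto simp: module_sum_def PiE_iff intro!: restrict_ext LinearCombinations.module_hom_add[OF mod_hom.f_hom[OF H]])
  next
    fix c x assume "x \<in> carrier (module_sum I V)"
    then show "(\<lambda>i\<in>I. h i ((c \<odot>\<^bsub>module_sum I V\<^esub> x) i)) =
        c \<odot>\<^bsub>module_sum I W\<^esub> (\<lambda>i\<in>I. h i (x i))"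
      by (auto simp: module_sum_def PiE_iff intro!: restrict_ext LinearCombinations.module_hom_smult[OF mod_hom.f_hom[OF H]])
  qed (intro vectorspace_module_sum V W; assumption)+
qed

lemma kronecker_rep_sum:
  fixes M :: "'i \<Rightarrow> ('k::field, 'v, 'w) kronecker"
  assumes M: "\<And>i. i \<in> I \<Longrightarrow> kronecker_rep (M i)"
    and "finite {i \<in> I. carrier (dom_space (M i)) \<noteq> {\<zero>\<^bsub>dom_space (M i)\<^esub>}}"
    and "finite {i \<in> I. carrier (cod_space (M i)) \<noteq> {\<zero>\<^bsub>cod_space (M i)\<^esub>}}"
  shows "kronecker_rep (kronecker_sum I M)"
proof -
  have "vectorspace class_ring (dom_space (M i))" "vectorspace class_ring (cod_space (M i))"
    if "i \<in> I" for i
    using M[OF that] by (simp_all add: kronecker_rep_def linear_map_def)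
  then show ?thesis
    using assms
    by (auto simp: kronecker_rep_def kronecker_sum_def
        intro!: linear_map_module_sum fin_dim_module_sum)
qed

lemma kronecker_rep_matrix_rep:
  fixes A B :: "'k::field mat"
  assumes "A \<in> carrier_mat n n" "B \<in> carrier_mat n n"
  shows "kronecker_rep (matrix_rep n A B)"
proof -
  interpret vec_space "TYPE('k)" n .
  have "linear_map class_ring (module_vec TYPE('k) n) (module_vec TYPE('k) n) (\<lambda>v. C *\<^sub>v v)"
    if "C \<in> carrier_mat n n" for C
    by (rule linear_mapI)
      (use that in \<open>auto simp: vec_vs module_vec_simps mult_add_distrib_mat_vec mult_mat_vec\<close>)
  then show ?thesis
    using assms fin_dim by (simp add: kronecker_rep_def matrix_rep_def)
qed

lemma kronecker_rep_R_rep: "kronecker_rep (R_rep p n)"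
  by (cases p) (auto intro!: kronecker_rep_matrix_rep)

lemma kronecker_rep_regular_rep:
  fixes m :: "'k::field proj_line \<Rightarrow> nat"
  assumes "finite {p. m p \<noteq> 0}"
  shows "kronecker_rep (regular_rep m b)"
  unfolding regular_rep_def
proof (rule kronecker_rep_sum)
  show "kronecker_rep (kronecker_sum {1..m p} (\<lambda>i. R_rep p (b p i)))" for p
    by (rule kronecker_rep_sum) (auto intro: kronecker_rep_R_rep)
qed (auto simp: kronecker_sum_def module_sum_def intro!: finite_subset[OF _ assms])

end

theory Submission
  imports Defs
begin

text \<open>
  If the sizes compare, the \<open>i\<close>-th block \<^term>\<open>R_rep p (e p i)\<close> embeds into the \<open>i\<close>-th block
  \<^term>\<open>R_rep p (b p i)\<close> by appending zeros to a vector: \<open>J\<close> is upper triangular, so the span of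
  the leading basis vectors is invariant.  The direct sum of these embeddings, with the
  surplus blocks of the larger representation left out of the image, is the required one
  (\<open>subrep_regular_rep\<close>).

  For the converse, fix \<open>p\<close>.  A Jordan chain of length \<open>k\<close> at \<open>p\<close> is a sequence
  \<open>0 = v 0, v 1, \<dots>, v k\<close> of domain vectors with \<open>(g - p f) (v (j + 1)) = f (v j)\<close>, where
  \<open>g - p f\<close> and \<open>f\<close> are replaced by \<open>f\<close> and \<open>g\<close> if \<open>p\<close> is the point at infinity.
  Morphisms map chains to chains, and a chain in a direct sum is a chain in every component.
  On \<open>R_rep q n\<close> with \<open>q \<noteq> p\<close> the operator on the left is invertible, so \<open>v 1 = 0\<close>; on
  \<open>R_rep p n\<close> the condition reads \<open>J (v (j + 1)) = v j\<close>, so \<open>v 1\<close> lies in the kernel of \<open>J\<close> and in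
  the image of \<open>J ^ (k - 1)\<close>, a line if \<open>k \<le> n\<close> and zero otherwise.  Hence the heads \<open>v 1\<close> of
  chains of length \<open>k\<close> in a regular representation form a space whose dimension is the number of
  blocks at \<open>p\<close> of size at least \<open>k\<close>, and an injective morphism cannot decrease that number.

  The dimension count is made concrete as follows.  Suppose the comparison fails at index \<open>i\<close>, and
  put \<open>k = e p i\<close>.  The first \<open>i\<close> blocks of the smaller representation carry an \<open>i\<close>-parameter
  family of chains (\<open>jordan_chain_chain_combination\<close>), while the head of a chain in the larger one is
  determined by fewer than \<open>i\<close> coordinates (\<open>jordan_chain_regular_rep_head_eq_0\<close>).  Fewer than \<open>i\<close>
  linear functionals have a common nontrivial zero (\<open>common_zero_of_few_functionals\<close>), so some
  nonzero head would be mapped to zero.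
\<close>


section \<open>Common zeros of linear functionals\<close>

text \<open>
  By elimination.  Given one more functional, two solutions \<open>x\<close> and \<open>y\<close> for the previous ones,
  with \<open>x\<close> nonzero at a place where \<open>y\<close> vanishes, are linearly independent, and a suitable
  combination of them is killed by the new functional too.
\<close>
lemma common_zero_of_few_functionals:
  fixes L :: "'j \<Rightarrow> ('i \<Rightarrow> 'k::field) \<Rightarrow> 'k"
  assumes "finite J" and "finite I" and "card J < card I"
    and lin: "\<And>j c x d y. j \<in> J \<Longrightarrow> L j (\<lambda>i. c * x i + d * y i) = c * L j x + d * L j y"
  shows "\<exists>x. (\<forall>i. i \<notin> I \<longrightarrow> x i = 0) \<and> (\<exists>i\<in>I. x i \<noteq> 0) \<and> (\<forall>j\<in>J. L j x = 0)"
  using assms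
proof (induction J arbitrary: I rule: finite_induct)
  case empty
  then obtain i where "i \<in> I"
    by fastforce
  then show ?case
    by (intro exI[of _ "\<lambda>i'. if i' = i then 1 else 0"]) auto
next
  case (insert j J)
  have IH: "\<exists>x. (\<forall>i'. i' \<notin> I - {i} \<longrightarrow> x i' = 0) \<and> (\<exists>i'\<in>I - {i}. x i' \<noteq> 0) \<and> (\<forall>j\<in>J. L j x = 0)"
    if "i \<in> I" for i
    using insert.prems insert.hyps that by (intro insert.IH) auto
  obtain i0 where "i0 \<in> I"
    using insert.prems by fastforce
  with IH obtain x i1 where x: "\<And>i. i \<notin> I \<Longrightarrow> x i = 0" "i1 \<in> I" "x i1 \<noteq> 0" "\<And>j. j \<in> J \<Longrightarrow> L j x = 0"
    by (metis Diff_iff)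
  from IH[OF x(2)] obtain y i2 where
    y: "\<And>i. i \<notin> I \<Longrightarrow> y i = 0" "y i1 = 0" "i2 \<in> I" "y i2 \<noteq> 0" "\<And>j. j \<in> J \<Longrightarrow> L j y = 0"
    by (metis Diff_iff singletonI)
  define z where "z = (\<lambda>i. L j y * x i + - L j x * y i)"
  have Lz: "L j' z = L j y * L j' x + - L j x * L j' y" if "j' \<in> insert j J" for j'
    unfolding z_def by (rule insert.prems(3)) (rule that)
  show ?case
  proof (cases "L j y = 0")
    case True
    then show ?thesis
      using y by (intro exI[of _ y]) auto
  next
    case False
    then have "z i1 \<noteq> 0"
      using x y by (simp add: z_def)
    then show ?thesis
      using x y Lz by (intro exI[of _ z] conjI bexI[of _ i1]) (auto simp: z_def)
  qed
qed

section \<open>Jordan chains of a pencil\<close>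

text \<open>
  At a finite point this is \<open>(g - p f) v = f u\<close>, written without subtraction in the codomain.
\<close>
fun jordan_step :: "'k::field proj_line \<Rightarrow> ('k, 'v, 'w) kronecker \<Rightarrow> 'v \<Rightarrow> 'v \<Rightarrow> bool" where
  "jordan_step (Finite p) M u v \<longleftrightarrow>
     map_g M v = p \<odot>\<^bsub>cod_space M\<^esub> map_f M v \<oplus>\<^bsub>cod_space M\<^esub> map_f M u"
| "jordan_step Infinity M u v \<longleftrightarrow> map_f M v = map_g M u"

definition jordan_chain ::
    "'k::field proj_line \<Rightarrow> ('k, 'v, 'w) kronecker \<Rightarrow> nat \<Rightarrow> (nat \<Rightarrow> 'v) \<Rightarrow> bool" where
  "jordan_chain p M k c \<longleftrightarrow> c 0 = \<zero>\<^bsub>dom_space M\<^esub> \<and>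
     (\<forall>j\<le>k. c j \<in> carrier (dom_space M)) \<and> (\<forall>j<k. jordan_step p M (c j) (c (Suc j)))"

lemma linear_map_closed:
  assumes "linear_map class_ring V W h" "x \<in> carrier V"
  shows "h x \<in> carrier W"
  using assms mod_hom.f_im[of class_ring V W h] by (simp add: linear_map_def)

lemma linear_map_zero:
  assumes "linear_map class_ring V W h"
  shows "h \<zero>\<^bsub>V\<^esub> = \<zero>\<^bsub>W\<^esub>"
  using assms mod_hom.f0_is_0[of class_ring V W h] by (simp add: linear_map_def)

lemma linear_map_add:
  assumes "linear_map class_ring V W h" "x \<in> carrier V" "y \<in> carrier V"
  shows "h (x \<oplus>\<^bsub>V\<^esub> y) = h x \<oplus>\<^bsub>W\<^esub> h y"
  using assms LinearCombinations.module_hom_add[OF mod_hom.f_hom, of class_ring V W h x y]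
  by (simp add: linear_map_def)

lemma linear_map_smult:
  fixes V :: "('k::field, 'v) module"
  assumes "linear_map class_ring V W h" "x \<in> carrier V"
  shows "h (a \<odot>\<^bsub>V\<^esub> x) = a \<odot>\<^bsub>W\<^esub> h x"
  using assms LinearCombinations.module_hom_smult[OF mod_hom.f_hom, of class_ring V W h a x]
  by (simp add: linear_map_def)

lemma vectorspace_smult_closed:
  fixes V :: "('k::field, 'v) module"
  assumes "vectorspace class_ring V" "x \<in> carrier V"
  shows "a \<odot>\<^bsub>V\<^esub> x \<in> carrier V"
  using assms module.smult_closed[of class_ring V a x] by (simp add: vectorspace_def)

lemma vectorspace_l_zero:
  assumes "vectorspace class_ring V"
  shows "\<zero>\<^bsub>V\<^esub> \<in> carrier V" "\<zero>\<^bsub>V\<^esub> \<oplus>\<^bsub>V\<^esub> \<zero>\<^bsub>V\<^esub> = \<zero>\<^bsub>V\<^esub>"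
proof -
  interpret vectorspace class_ring V by fact
  show "\<zero>\<^bsub>V\<^esub> \<in> carrier V" "\<zero>\<^bsub>V\<^esub> \<oplus>\<^bsub>V\<^esub> \<zero>\<^bsub>V\<^esub> = \<zero>\<^bsub>V\<^esub>" by simp_all
qed

text \<open>
  The defining equations are linear in \<open>f\<close> and \<open>g\<close>, so they are transported along any
  commuting pair of linear maps.
\<close>
lemma jordan_chain_morphism:
  assumes "kronecker_rep N" and \<phi>: "linear_map class_ring (dom_space N) (dom_space M) \<phi>"
    and \<psi>: "linear_map class_ring (cod_space N) (cod_space M) \<psi>"
    and comm: "\<And>v. v \<in> carrier (dom_space N) \<Longrightarrow> map_f M (\<phi> v) = \<psi> (map_f N v)"
      "\<And>v. v \<in> carrier (dom_space N) \<Longrightarrow> map_g M (\<phi> v) = \<psi> (map_g N v)"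
    and c: "jordan_chain p N k c"
  shows "jordan_chain p M k (\<lambda>j. \<phi> (c j))"
proof -
  have f: "linear_map class_ring (dom_space N) (cod_space N) (map_f N)"
    using assms(1) by (simp add: kronecker_rep_def)
  have W: "vectorspace class_ring (cod_space N)"
    using f by (simp add: linear_map_def)
  note closed = linear_map_closed[OF f]
  have "jordan_step p M (\<phi> u) (\<phi> v)"
    if "jordan_step p N u v" and "u \<in> carrier (dom_space N)" "v \<in> carrier (dom_space N)" for u v
    using that
    by (cases p) (simp_all add: comm linear_map_add[OF \<psi>] linear_map_smult[OF \<psi>] closed
        vectorspace_smult_closed[OF W])
  then show ?thesis
    using c by (auto simp: jordan_chain_def linear_map_zero[OF \<phi>] linear_map_closed[OF \<phi>])
qed

lemma jordan_step_sum_iff: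
  "jordan_step p (kronecker_sum I M) u v \<longleftrightarrow> (\<forall>i\<in>I. jordan_step p (M i) (u i) (v i))"
  by (cases p) (auto simp: kronecker_sum_def module_sum_def fun_eq_iff restrict_def)

lemma jordan_chain_sumD:
  assumes "jordan_chain p (kronecker_sum I M) k c" "i \<in> I"
  shows "jordan_chain p (M i) k (\<lambda>j. c j i)"
  using assms unfolding jordan_chain_def jordan_step_sum_iff
  by (auto simp: kronecker_sum_def module_sum_def)

lemma jordan_chain_sumI:
  assumes c: "\<And>i. i \<in> I \<Longrightarrow> jordan_chain p (M i) k (c i)"
    and fin: "finite {i \<in> I. \<exists>j. c i j \<noteq> \<zero>\<^bsub>dom_space (M i)\<^esub>}"
  shows "jordan_chain p (kronecker_sum I M) k (\<lambda>j. \<lambda>i\<in>I. c i j)"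
proof -
  have "finite {i \<in> I. c i j \<noteq> \<zero>\<^bsub>dom_space (M i)\<^esub>}" for j
    by (rule finite_subset[OF _ fin]) auto
  then show ?thesis
    using c unfolding jordan_chain_def jordan_step_sum_iff
    by (auto simp: kronecker_sum_def module_sum_def cong: conj_cong)
qed

lemma jordan_chain_zero:
  assumes "kronecker_rep M"
  shows "jordan_chain p M k (\<lambda>_. \<zero>\<^bsub>dom_space M\<^esub>)"
proof -
  have f: "linear_map class_ring (dom_space M) (cod_space M) (map_f M)"
    and g: "linear_map class_ring (dom_space M) (cod_space M) (map_g M)"
    using assms by (simp_all add: kronecker_rep_def)
  have V: "vectorspace class_ring (dom_space M)" and W: "vectorspace class_ring (cod_space M)"
    using f by (simp_all add: linear_map_def)
  have "a \<odot>\<^bsub>cod_space M\<^esub> \<zero>\<^bsub>cod_space M\<^esub> = \<zero>\<^bsub>cod_space M\<^esub>" for a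
    using W module.smult_r_null[of class_ring "cod_space M" a] by (simp add: vectorspace_def)
  then show ?thesis
    by (cases p) (simp_all add: jordan_chain_def linear_map_zero[OF f] linear_map_zero[OF g]
        vectorspace_l_zero[OF V] vectorspace_l_zero[OF W])
qed

section \<open>Jordan chains in a single block\<close>

lemma space_R_rep [simp]:
  fixes p :: "'k::field proj_line"
  shows "dom_space (R_rep p n) = module_vec TYPE('k) n"
    "cod_space (R_rep p n) = module_vec TYPE('k) n"
  by (cases p; simp add: matrix_rep_def)+

lemma jordan_block_0_mult_vec:
  fixes v :: "'k::field vec"
  assumes "v \<in> carrier_vec n"
  shows "jordan_block n 0 *\<^sub>v v = vec n (\<lambda>a. if Suc a < n then v $ Suc a else 0)"
proof (rule eq_vecI)
  fix a assume "a < dim_vec (vec n (\<lambda>a. if Suc a < n then v $ Suc a else 0))"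
  then have a: "a < n" by simp
  have "(jordan_block n 0 *\<^sub>v v) $ a = (\<Sum>i<n. jordan_block n 0 $$ (a, i) * v $ i)"
    using a assms by (simp add: scalar_prod_def atLeast0LessThan)
  also have "\<dots> = (\<Sum>i<n. if i = Suc a then v $ i else 0)"
    using a by (intro sum.cong) auto
  finally show "(jordan_block n 0 *\<^sub>v v) $ a = vec n (\<lambda>a. if Suc a < n then v $ Suc a else 0) $ a"
    using a by simp
qed simp

lemma smult_one_add_mult_vec:
  fixes v :: "'k::field vec"
  assumes "v \<in> carrier_vec n"
  shows "(p \<cdot>\<^sub>m 1\<^sub>m n + jordan_block n 0) *\<^sub>v v = p \<cdot>\<^sub>v v + jordan_block n 0 *\<^sub>v v"
proof -
  have "(p \<cdot>\<^sub>m 1\<^sub>m n) *\<^sub>v v = p \<cdot>\<^sub>v v"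
    using assms by (intro eq_vecI) simp_all
  then show ?thesis
    using assms by (simp add: add_mult_distrib_mat_vec[of _ n n])
qed

lemma jordan_step_R_rep_same:
  assumes "u \<in> carrier_vec n" "v \<in> carrier_vec n"
  shows "jordan_step p (R_rep p n) u v \<longleftrightarrow> jordan_block n 0 *\<^sub>v v = u"
proof (cases p)
  case (Finite r)
  have J: "jordan_block n 0 *\<^sub>v v \<in> carrier_vec n"
    using assms by (simp add: jordan_block_0_mult_vec)
  have "r \<cdot>\<^sub>v v + jordan_block n 0 *\<^sub>v v = r \<cdot>\<^sub>v v + u \<longleftrightarrow> jordan_block n 0 *\<^sub>v v = u"
    using J assms by (auto simp: vec_eq_iff)
  then show ?thesis
    using Finite assms smult_one_add_mult_vec[OF assms(2)]
    by (simp add: matrix_rep_def module_vec_simps)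
next
  case Infinity
  then show ?thesis using assms by (simp add: matrix_rep_def)
qed

text \<open>
  This is the invertibility of \<open>1 - c J\<close> for nilpotent \<open>J\<close>.  The entry of \<open>v\<close> at \<open>a\<close> is \<open>c\<close> times
  the entry at \<open>a + 1\<close> and the last entry is zero, so the entries vanish one after another,
  counted from the end.
\<close>
lemma one_minus_nilpotent_injective:
  fixes v :: "'k::field vec"
  assumes v: "v \<in> carrier_vec n" and eq: "v = c \<cdot>\<^sub>v (jordan_block n 0 *\<^sub>v v)"
  shows "v = 0\<^sub>v n"
proof -
  have rev: "v $ (n - Suc a) = 0" if "a < n" for a
    using that
  proof (induction a)
    case 0
    then show ?case using v by (subst eq) (simp add: jordan_block_0_mult_vec)
  next
    case (Suc a)
    then have "v $ Suc (n - Suc (Suc a)) = 0"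
      by (simp add: Suc_diff_Suc)
    with Suc show ?case using v by (subst eq) (simp add: jordan_block_0_mult_vec)
  qed
  then have "v $ a = 0" if "a < n" for a
    using rev[of "n - Suc a"] that by simp
  then show ?thesis using v by auto
qed

text \<open>
  In each combination of \<open>p\<close> and \<open>q\<close> the equation reads \<open>v = c J v\<close> for some scalar \<open>c\<close>, or is
  \<open>v = 0\<close> itself: for distinct finite points \<open>r\<close> and \<open>s\<close> the scalar is the inverse of \<open>s - r\<close>.
\<close>
lemma jordan_step_R_rep_other:
  assumes "q \<noteq> p" and v: "v \<in> carrier_vec n" and step: "jordan_step p (R_rep q n) (0\<^sub>v n) v"
  shows "v = 0\<^sub>v n"
proof -
  note [simp] = matrix_rep_def module_vec_simps smult_one_add_mult_vec
  show ?thesis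
  proof (cases q; cases p)
    fix r s assume q: "q = Finite r" and p: "p = Finite s"
    define J where "J = jordan_block n 0 *\<^sub>v v"
    have J: "J \<in> carrier_vec n" using v by (simp add: J_def jordan_block_0_mult_vec)
    have "r \<cdot>\<^sub>v v + J = s \<cdot>\<^sub>v v"
      using step v by (simp add: q p J_def)
    then have "r * v $ a + J $ a = s * v $ a" if "a < n" for a
      using that v J by (auto simp: vec_eq_iff)
    then have "v $ a = inverse (s - r) * J $ a" if "a < n" for a
      using that assms(1) by (simp add: q p field_simps)
    then have "v = inverse (s - r) \<cdot>\<^sub>v J"
      using v J by auto
    then show ?thesis
      unfolding J_def by (rule one_minus_nilpotent_injective[OF v])
  next
    fix s assume "q = Infinity" "p = Finite s"
    then have "v = s \<cdot>\<^sub>v (jordan_block n 0 *\<^sub>v v)"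
      using step v by (auto simp: vec_eq_iff jordan_block_0_mult_vec)
    then show ?thesis
      by (rule one_minus_nilpotent_injective[OF v])
  next
    fix r assume "q = Finite r" "p = Infinity"
    then show ?thesis
      using step v by (auto simp: jordan_block_0_mult_vec)
  next
    assume "q = Infinity" "p = Infinity"
    with assms(1) show ?thesis by simp
  qed
qed

lemma jordan_chain_R_rep_other:
  assumes "q \<noteq> p" and "jordan_chain p (R_rep q n) k c" and "0 < k"
  shows "c 1 = 0\<^sub>v n"
  using assms jordan_step_R_rep_other[OF assms(1), of "c 1" n]
  by (auto simp: jordan_chain_def module_vec_simps)

text \<open>
  The line of possible heads: \<open>J (c 1) = c 0 = 0\<close> leaves only the entry at \<open>0\<close>, and pulling this entry
  back along \<open>J\<close> moves it from position \<open>0\<close> of \<open>c 1\<close> to position \<open>k - 1\<close> of \<open>c k\<close>, which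
  requires \<open>k - 1 < n\<close>.
\<close>
lemma jordan_chain_R_rep_same:
  assumes c: "jordan_chain p (R_rep p n) k c" and "0 < k" and "a < n" and "c 1 $ a \<noteq> 0"
  shows "a = 0 \<and> k \<le> n"
proof -
  have cV: "c j \<in> carrier_vec n" if "j \<le> k" for j
    using c that by (simp add: jordan_chain_def module_vec_simps)
  have shift: "c j = jordan_block n 0 *\<^sub>v c (Suc j)" if "j < k" for j
  proof -
    have "jordan_step p (R_rep p n) (c j) (c (Suc j))"
      using c that by (simp add: jordan_chain_def)
    then show ?thesis
      using that by (subst (asm) jordan_step_R_rep_same) (auto simp: cV)
  qed
  have shift': "c j $ a = (if Suc a < n then c (Suc j) $ Suc a else 0)" if "j < k" "a < n" for j a
    using that cV[of "Suc j"] by (subst shift) (simp_all add: jordan_block_0_mult_vec)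
  have "a = 0"
  proof (rule ccontr)
    assume "a \<noteq> 0"
    then have "c 0 $ (a - 1) = c 1 $ a"
      using shift'[of 0 "a - 1"] assms by simp
    moreover have "c 0 = 0\<^sub>v n"
      using c by (simp add: jordan_chain_def module_vec_simps)
    ultimately show False
      using assms by simp
  qed
  moreover have "i < n \<and> c (Suc i) $ i \<noteq> 0" if "i < k" for i
    using that
  proof (induction i)
    case 0
    then show ?case using assms \<open>a = 0\<close> by simp
  next
    case (Suc i)
    then show ?case using shift'[of "Suc i" i] by (auto split: if_splits)
  qed
  from this[of "k - 1"] have "k \<le> n"
    using assms by auto
  ultimately show ?thesis by simp
qed

lemma jordan_chain_R_rep_unit_vec:
  assumes "k \<le> n"
  shows "jordan_chain p (R_rep p n) k (\<lambda>j. if j = 0 then 0\<^sub>v n else x \<cdot>\<^sub>v unit_vec n (j - 1))"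
  using assms unfolding jordan_chain_def
  by (auto simp: jordan_step_R_rep_same module_vec_simps jordan_block_0_mult_vec unit_vec_def vec_eq_iff)

section \<open>Embeddings of direct sums\<close>

lemma subrep_R_rep:
  fixes p :: "'k::field proj_line"
  assumes "d \<le> n"
  shows "subrep (R_rep p d) (R_rep p n)"
proof -
  define pad :: "'k vec \<Rightarrow> 'k vec" where "pad v = vec n (\<lambda>a. if a < d then v $ a else 0)" for v
  have vs: "vectorspace class_ring (module_vec TYPE('k) n')" for n'
    using kronecker_rep_R_rep[of p n'] by (simp add: kronecker_rep_def linear_map_def)
  have lin: "linear_map class_ring (module_vec TYPE('k) d) (module_vec TYPE('k) n) pad"
    by (rule linear_mapI[OF vs vs]) (use assms in \<open>auto simp: pad_def module_vec_simps\<close>)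
  have "inj_on pad (carrier_vec d)"
  proof (rule inj_onI)
    fix v w assume vw: "v \<in> carrier_vec d" "w \<in> carrier_vec d" "pad v = pad w"
    show "v = w"
    proof (rule eq_vecI)
      fix a assume "a < dim_vec w"
      then have "a < d" using vw by simp
      moreover have "pad v $ a = pad w $ a" using vw by simp
      ultimately show "v $ a = w $ a" using assms by (simp add: pad_def)
    qed (use vw in simp)
  qed
  moreover have J: "jordan_block n 0 *\<^sub>v pad v = pad (jordan_block d 0 *\<^sub>v v)" if "v \<in> carrier_vec d" for v
  proof -
    have "pad v \<in> carrier_vec n" by (simp add: pad_def)
    then show ?thesis
      using that assms by (auto simp: jordan_block_0_mult_vec pad_def vec_eq_iff)
  qed
  moreover have "map_f (R_rep p n) (pad v) = pad (map_f (R_rep p d) v) \<and>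
      map_g (R_rep p n) (pad v) = pad (map_g (R_rep p d) v)" if v: "v \<in> carrier_vec d" for v
  proof -
    have pv: "pad v \<in> carrier_vec n" by (simp add: pad_def)
    have "pad (r \<cdot>\<^sub>v v + jordan_block d 0 *\<^sub>v v) = r \<cdot>\<^sub>v pad v + pad (jordan_block d 0 *\<^sub>v v)" for r
      using v assms by (auto simp: pad_def jordan_block_0_mult_vec)
    then show ?thesis
      using v pv J[OF v] by (cases p) (simp_all add: matrix_rep_def smult_one_add_mult_vec)
  qed
  ultimately show ?thesis
    unfolding subrep_def using lin kronecker_rep_R_rep
    by (intro conjI exI[of _ pad]) (auto simp: module_vec_simps)
qed

text \<open>
  The target may have additional summands, whose components in the image are zero.  At a point \<open>p\<close>
  they are the blocks of the larger representation beyond those of the smaller one.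
\<close>
lemma linear_map_module_sum_extend:
  fixes V :: "'i \<Rightarrow> ('k::field, 'v) module" and W :: "'i \<Rightarrow> ('k, 'w) module"
  assumes "I \<subseteq> J" and h: "\<And>i. i \<in> I \<Longrightarrow> linear_map class_ring (V i) (W i) (h i)"
    and W: "\<And>i. i \<in> J \<Longrightarrow> vectorspace class_ring (W i)"
  defines "H \<equiv> \<lambda>x. \<lambda>i\<in>J. if i \<in> I then h i (x i) else \<zero>\<^bsub>W i\<^esub>"
  shows "linear_map class_ring (module_sum I V) (module_sum J W) H"
    and "(\<And>i. i \<in> I \<Longrightarrow> inj_on (h i) (carrier (V i))) \<Longrightarrow> inj_on H (carrier (module_sum I V))"
proof -
  have V: "vectorspace class_ring (V i)" if "i \<in> I" for i
    using h[OF that] by (simp add: linear_map_def)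
  have Wnull: "a \<odot>\<^bsub>W i\<^esub> \<zero>\<^bsub>W i\<^esub> = \<zero>\<^bsub>W i\<^esub>" if "i \<in> J" for a i
    using W[OF that] module.smult_r_null[of class_ring "W i" a] by (simp add: vectorspace_def)
  note [simp] = linear_map_closed[OF h] linear_map_zero[OF h] linear_map_add[OF h]
    linear_map_smult[OF h] vectorspace_l_zero[OF W] Wnull
  show "linear_map class_ring (module_sum I V) (module_sum J W) H"
  proof (rule linear_mapI)
    fix x assume x: "x \<in> carrier (module_sum I V)"
    have "finite {i \<in> J. H x i \<noteq> \<zero>\<^bsub>W i\<^esub>}"
      by (rule finite_subset[of _ "{i \<in> I. x i \<noteq> \<zero>\<^bsub>V i\<^esub>}"])
        (use x in \<open>auto simp: module_sum_def H_def\<close>)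
    then show "H x \<in> carrier (module_sum J W)"
      using x by (auto simp: module_sum_def PiE_iff H_def)
  next
    fix x y assume "x \<in> carrier (module_sum I V)" "y \<in> carrier (module_sum I V)"
    then show "H (x \<oplus>\<^bsub>module_sum I V\<^esub> y) = H x \<oplus>\<^bsub>module_sum J W\<^esub> H y"
      using \<open>I \<subseteq> J\<close> by (auto simp: module_sum_def PiE_iff H_def intro!: restrict_ext)
  next
    fix c x assume "x \<in> carrier (module_sum I V)"
    then show "H (c \<odot>\<^bsub>module_sum I V\<^esub> x) = c \<odot>\<^bsub>module_sum J W\<^esub> H x"
      using \<open>I \<subseteq> J\<close> by (auto simp: module_sum_def PiE_iff H_def intro!: restrict_ext)
  qed (intro vectorspace_module_sum V W; assumption)+
  assume inj: "\<And>i. i \<in> I \<Longrightarrow> inj_on (h i) (carrier (V i))"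
  show "inj_on H (carrier (module_sum I V))"
  proof (rule inj_onI)
    fix x y assume xy: "x \<in> carrier (module_sum I V)" "y \<in> carrier (module_sum I V)" "H x = H y"
    have "x i = y i" if "i \<in> I" for i
    proof -
      have "H x i = H y i" using xy by simp
      then show ?thesis
        using that \<open>I \<subseteq> J\<close> xy inj_onD[OF inj[OF that], of "x i" "y i"]
        by (auto simp: H_def module_sum_def subset_iff)
    qed
    then show "x = y"
      using xy by (auto simp: module_sum_def intro: PiE_ext)
  qed
qed

lemma subrep_kronecker_sum:
  fixes N :: "'i \<Rightarrow> ('k::field, 'v1, 'w1) kronecker" and M :: "'i \<Rightarrow> ('k, 'v2, 'w2) kronecker"
  assumes "I \<subseteq> J" and sub: "\<And>i. i \<in> I \<Longrightarrow> subrep (N i) (M i)"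
    and M: "\<And>i. i \<in> J \<Longrightarrow> kronecker_rep (M i)"
    and sums: "kronecker_rep (kronecker_sum I N)" "kronecker_rep (kronecker_sum J M)"
  shows "subrep (kronecker_sum I N) (kronecker_sum J M)"
proof -
  have "\<forall>i\<in>I. \<exists>\<phi> \<psi>. linear_map class_ring (dom_space (N i)) (dom_space (M i)) \<phi> \<and>
      linear_map class_ring (cod_space (N i)) (cod_space (M i)) \<psi> \<and>
      inj_on \<phi> (carrier (dom_space (N i))) \<and> inj_on \<psi> (carrier (cod_space (N i))) \<and>
      (\<forall>v\<in>carrier (dom_space (N i)). map_f (M i) (\<phi> v) = \<psi> (map_f (N i) v)) \<and>
      (\<forall>v\<in>carrier (dom_space (N i)). map_g (M i) (\<phi> v) = \<psi> (map_g (N i) v))"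
    using sub by (simp add: subrep_def)
  then obtain \<phi> \<psi> where
      \<phi>: "\<And>i. i \<in> I \<Longrightarrow> linear_map class_ring (dom_space (N i)) (dom_space (M i)) (\<phi> i)"
      "\<And>i. i \<in> I \<Longrightarrow> inj_on (\<phi> i) (carrier (dom_space (N i)))"
    and \<psi>: "\<And>i. i \<in> I \<Longrightarrow> linear_map class_ring (cod_space (N i)) (cod_space (M i)) (\<psi> i)"
      "\<And>i. i \<in> I \<Longrightarrow> inj_on (\<psi> i) (carrier (cod_space (N i)))"
    and comm: "\<And>i v. i \<in> I \<Longrightarrow> v \<in> carrier (dom_space (N i)) \<Longrightarrow>
        map_f (M i) (\<phi> i v) = \<psi> i (map_f (N i) v)"
      "\<And>i v. i \<in> I \<Longrightarrow> v \<in> carrier (dom_space (N i)) \<Longrightarrow>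
        map_g (M i) (\<phi> i v) = \<psi> i (map_g (N i) v)"
    unfolding bchoice_iff by blast
  have vs: "vectorspace class_ring (dom_space (M i))" "vectorspace class_ring (cod_space (M i))"
    if "i \<in> J" for i
    using M[OF that] by (simp_all add: kronecker_rep_def linear_map_def)
  have zero: "map_f (M i) \<zero>\<^bsub>dom_space (M i)\<^esub> = \<zero>\<^bsub>cod_space (M i)\<^esub>"
    "map_g (M i) \<zero>\<^bsub>dom_space (M i)\<^esub> = \<zero>\<^bsub>cod_space (M i)\<^esub>" if "i \<in> J" for i
    using M[OF that] by (simp_all add: kronecker_rep_def linear_map_zero)
  define \<Phi> where "\<Phi> x = (\<lambda>i\<in>J. if i \<in> I then \<phi> i (x i) else \<zero>\<^bsub>dom_space (M i)\<^esub>)" for x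
  define \<Psi> where "\<Psi> x = (\<lambda>i\<in>J. if i \<in> I then \<psi> i (x i) else \<zero>\<^bsub>cod_space (M i)\<^esub>)" for x
  let ?N = "kronecker_sum I N" and ?M = "kronecker_sum J M"
  have "linear_map class_ring (dom_space ?N) (dom_space ?M) \<Phi> \<and> inj_on \<Phi> (carrier (dom_space ?N))"
    using linear_map_module_sum_extend[OF \<open>I \<subseteq> J\<close> \<phi>(1) vs(1)] \<phi>(2)
    by (simp add: kronecker_sum_def \<Phi>_def[abs_def])
  moreover have "linear_map class_ring (cod_space ?N) (cod_space ?M) \<Psi> \<and>
      inj_on \<Psi> (carrier (cod_space ?N))"
    using linear_map_module_sum_extend[OF \<open>I \<subseteq> J\<close> \<psi>(1) vs(2)] \<psi>(2)
    by (simp add: kronecker_sum_def \<Psi>_def[abs_def])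
  moreover have "map_f ?M (\<Phi> v) = \<Psi> (map_f ?N v) \<and> map_g ?M (\<Phi> v) = \<Psi> (map_g ?N v)"
    if "v \<in> carrier (dom_space ?N)" for v
    using that \<open>I \<subseteq> J\<close> comm zero
    by (auto simp: kronecker_sum_def module_sum_def \<Phi>_def \<Psi>_def PiE_iff intro!: restrict_ext)
  ultimately show ?thesis
    unfolding subrep_def using sums by blast
qed

lemma kronecker_rep_sum_R_rep: "kronecker_rep (kronecker_sum {1..(l::nat)} (\<lambda>i. R_rep p (d i)))"
  by (rule kronecker_rep_sum) (auto intro: kronecker_rep_R_rep)

lemma subrep_regular_rep:
  assumes "finite {p. m p \<noteq> 0}" and "finite {p. n p \<noteq> 0}"
    and le: "\<And>p. n p \<le> m p" "\<And>p i. 1 \<le> i \<Longrightarrow> i \<le> n p \<Longrightarrow> e p i \<le> b p i"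
  shows "subrep (regular_rep n e) (regular_rep m b)"
proof -
  have "subrep (kronecker_sum {1..n p} (\<lambda>i. R_rep p (e p i)))
      (kronecker_sum {1..m p} (\<lambda>i. R_rep p (b p i)))" for p
    using le
    by (intro subrep_kronecker_sum subrep_R_rep kronecker_rep_R_rep kronecker_rep_sum_R_rep) auto
  then show ?thesis
    using kronecker_rep_regular_rep[OF assms(1)] kronecker_rep_regular_rep[OF assms(2)]
    unfolding regular_rep_def
    by (intro subrep_kronecker_sum[of UNIV UNIV] kronecker_rep_sum_R_rep) simp_all
qed

section \<open>Comparison of block sizes\<close>

text \<open>
  The linear combination, with coefficients \<open>x i\<close>, of the standard chains of length \<open>k\<close>: in a block
  at \<open>p\<close> of size at least \<open>k\<close> the \<open>j\<close>-th vector of the standard chain, for \<open>j\<close> from \<open>1\<close>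
  to \<open>k\<close>, is the \<open>j\<close>-th basis vector, which has index \<open>j - 1\<close>.  It is written out on components so that its linearity in \<open>x\<close> is visible.
\<close>
definition chain_combination ::
    "'k::field proj_line \<Rightarrow> nat \<Rightarrow> ('k proj_line \<Rightarrow> nat) \<Rightarrow> ('k proj_line \<Rightarrow> nat \<Rightarrow> nat) \<Rightarrow>
     (nat \<Rightarrow> 'k) \<Rightarrow> nat \<Rightarrow> 'k proj_line \<Rightarrow> nat \<Rightarrow> 'k vec" where
  "chain_combination p k n e x j = (\<lambda>q. \<lambda>i\<in>{1..n q}.
     if q = p \<and> k \<le> e p i \<and> j \<noteq> 0 then x i \<cdot>\<^sub>v unit_vec (e p i) (j - 1) else 0\<^sub>v (e q i))"

lemma jordan_chain_chain_combination:
  "jordan_chain p (regular_rep n e) k (chain_combination p k n e x)"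
proof -
  define c where "c q i j = (if q = p \<and> k \<le> e p i \<and> j \<noteq> 0
      then x i \<cdot>\<^sub>v unit_vec (e p i) (j - 1) else 0\<^sub>v (e q i))" for q i j
  have block: "jordan_chain p (R_rep q (e q i)) k (c q i)" for q i
  proof (cases "q = p \<and> k \<le> e p i")
    case True
    then have "c q i = (\<lambda>j. if j = 0 then 0\<^sub>v (e p i) else x i \<cdot>\<^sub>v unit_vec (e p i) (j - 1))"
      by (auto simp: c_def)
    then show ?thesis
      using True jordan_chain_R_rep_unit_vec[of k "e p i" p "x i"] by simp
  next
    case False
    then have "c q i = (\<lambda>j. 0\<^sub>v (e q i))"
      by (auto simp: c_def)
    then show ?thesis
      using jordan_chain_zero[OF kronecker_rep_R_rep, of p q "e q i" k]
      by (simp add: module_vec_simps)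
  qed
  have "jordan_chain p (regular_rep n e) k (\<lambda>j. \<lambda>q\<in>UNIV. \<lambda>i\<in>{1..n q}. c q i j)"
    unfolding regular_rep_def
  proof (intro jordan_chain_sumI block)
    show "finite {q \<in> UNIV. \<exists>j. (\<lambda>i\<in>{1..n q}. c q i j) \<noteq>
        \<zero>\<^bsub>dom_space (kronecker_sum {1..n q} (\<lambda>i. R_rep q (e q i)))\<^esub>}"
      by (rule finite_subset[of _ "{p}"])
        (auto simp: kronecker_sum_def module_sum_def c_def module_vec_simps)
  qed simp
  then show ?thesis
    by (simp add: c_def chain_combination_def[abs_def] restrict_UNIV)
qed

text \<open>
  The coordinates of \<open>x p i\<close> are meaningful only inside the index set and below the size of the block;
  outside, the values of the functions involved are arbitrary and linearity
  may fail.
\<close>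
lemma coordinate_linear:
  fixes m :: "'k::field proj_line \<Rightarrow> nat"
  assumes "x \<in> carrier (dom_space (regular_rep m b))" "y \<in> carrier (dom_space (regular_rep m b))"
    and "i \<in> {1..m p}" and "a < b p i"
  shows "(s \<odot>\<^bsub>dom_space (regular_rep m b)\<^esub> x \<oplus>\<^bsub>dom_space (regular_rep m b)\<^esub>
      t \<odot>\<^bsub>dom_space (regular_rep m b)\<^esub> y) p i $ a = s * x p i $ a + t * y p i $ a"
proof -
  have "z p i \<in> carrier_vec (b p i)" if "z \<in> carrier (dom_space (regular_rep m b))" for z
    using that assms(3)
    by (auto simp: regular_rep_def kronecker_sum_def module_sum_def module_vec_simps PiE_iff)
  from this[OF assms(1)] this[OF assms(2)] show ?thesis
    using assms(3,4)
    by (auto simp: regular_rep_def kronecker_sum_def module_sum_def module_vec_simps)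
qed

text \<open>
  The blocks away from \<open>p\<close> and the blocks smaller than \<open>k\<close> contribute nothing to a head, and the
  remaining ones only their leading coordinate.
\<close>
lemma jordan_chain_regular_rep_head_eq_0:
  assumes c: "jordan_chain p (regular_rep m b) k c" and "0 < k"
    and coord: "\<And>i. i \<in> {1..m p} \<Longrightarrow> k \<le> b p i \<Longrightarrow> c 1 p i $ 0 = 0"
  shows "c 1 = \<zero>\<^bsub>dom_space (regular_rep m b)\<^esub>"
proof -
  have block: "jordan_chain p (R_rep q (b q i)) k (\<lambda>j. c j q i)" if "i \<in> {1..m q}" for q i
    using jordan_chain_sumD[OF jordan_chain_sumD[OF c[unfolded regular_rep_def] UNIV_I] that] .
  have "c 1 q i = 0\<^sub>v (b q i)" if i: "i \<in> {1..m q}" for q i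
  proof (cases "q = p")
    case True
    have "c 1 q i \<in> carrier_vec (b q i)"
      using block[OF i] \<open>0 < k\<close> by (auto simp: jordan_chain_def module_vec_simps)
    moreover have "c 1 q i $ a = 0" if "a < b q i" for a
      using jordan_chain_R_rep_same[of p "b p i" k "\<lambda>j. c j p i" a] block[OF i] coord[of i]
        that i \<open>0 < k\<close> True by auto
    ultimately show ?thesis by auto
  next
    case False
    then show ?thesis
      using jordan_chain_R_rep_other[OF False block[OF i] \<open>0 < k\<close>] by simp
  qed
  moreover have "c 1 \<in> carrier (dom_space (regular_rep m b))"
    using c \<open>0 < k\<close> by (auto simp: jordan_chain_def)
  ultimately show ?thesis
    by (auto simp: regular_rep_def kronecker_sum_def module_sum_def module_vec_simps PiE_iff
        fun_eq_iff extensional_def)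
qed

text \<open>
  As \<open>k = e p i\<close> and the sizes decrease, all blocks up to the \<open>i\<close>-th of the smaller representation
  have size at least \<open>k\<close>, whereas a failure at \<open>i\<close> means that the blocks of size at least \<open>k\<close>
  in the larger one have indices below \<open>i\<close>.
\<close>
lemma block_sizes_le_of_subrep:
  fixes m n :: "'k::field proj_line \<Rightarrow> nat"
  assumes sub: "subrep (regular_rep n e) (regular_rep m b)"
    and bpos: "\<And>j. 1 \<le> j \<Longrightarrow> j \<le> m p \<Longrightarrow> b p j > 0"
    and epos: "\<And>j. 1 \<le> j \<Longrightarrow> j \<le> n p \<Longrightarrow> e p j > 0"
    and bdec: "\<And>i j. 1 \<le> i \<Longrightarrow> i \<le> j \<Longrightarrow> j \<le> m p \<Longrightarrow> b p i \<ge> b p j"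
    and edec: "\<And>i j. 1 \<le> i \<Longrightarrow> i \<le> j \<Longrightarrow> j \<le> n p \<Longrightarrow> e p i \<ge> e p j"
    and i: "1 \<le> i" "i \<le> n p"
  shows "i \<le> m p \<and> e p i \<le> b p i"
proof (rule ccontr)
  assume neg: "\<not> (i \<le> m p \<and> e p i \<le> b p i)"
  define k where "k = e p i"
  have "0 < k"
    using epos i by (simp add: k_def)
  let ?N = "regular_rep n e" and ?M = "regular_rep m b"
  let ?V = "dom_space ?N" and ?U = "dom_space ?M"
  obtain \<phi> \<psi> where \<phi>: "linear_map class_ring ?V ?U \<phi>" "inj_on \<phi> (carrier ?V)"
    and \<psi>: "linear_map class_ring (cod_space ?N) (cod_space ?M) \<psi>"
    and comm: "\<And>v. v \<in> carrier ?V \<Longrightarrow> map_f ?M (\<phi> v) = \<psi> (map_f ?N v)"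
      "\<And>v. v \<in> carrier ?V \<Longrightarrow> map_g ?M (\<phi> v) = \<psi> (map_g ?N v)"
    and rep: "kronecker_rep ?N"
    using sub unfolding subrep_def by blast
  have V: "vectorspace class_ring ?V"
    using \<phi> by (simp add: linear_map_def)
  define head where "head x = chain_combination p k n e x 1" for x
  have head_carrier: "head x \<in> carrier ?V" for x
    using jordan_chain_chain_combination[of p n e k x] \<open>0 < k\<close>
    by (auto simp: head_def jordan_chain_def)
  have head_lin: "head (\<lambda>i. s * x i + t * y i) = s \<odot>\<^bsub>?V\<^esub> head x \<oplus>\<^bsub>?V\<^esub> t \<odot>\<^bsub>?V\<^esub> head y" for s t x y
    by (auto simp: head_def chain_combination_def regular_rep_def kronecker_sum_def module_sum_def
        module_vec_simps fun_eq_iff vec_eq_iff algebra_simps)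
  \<comment> \<open>blocks whose leading coordinates determine the head of a chain in the larger representation\<close>
  define J where "J = {j \<in> {1..m p}. k \<le> b p j}"
  have "j < i" if "j \<in> J" for j
    using neg bdec[of i j] i(1) that by (force simp: J_def k_def)
  then have "J \<subseteq> {1..<i}"
    by (auto simp: J_def)
  then have card: "card J < card {1..i}" and "finite J"
    using card_mono[of "{1..<i}" J] i(1) by (auto intro: finite_subset)
  have lin: "\<phi> (head (\<lambda>i. s * x i + t * y i)) p j $ 0 =
      s * \<phi> (head x) p j $ 0 + t * \<phi> (head y) p j $ 0" if "j \<in> J" for j s x t y
  proof -
    have "\<phi> (head (\<lambda>i. s * x i + t * y i)) =
        s \<odot>\<^bsub>?U\<^esub> \<phi> (head x) \<oplus>\<^bsub>?U\<^esub> t \<odot>\<^bsub>?U\<^esub> \<phi> (head y)"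
      by (simp add: head_lin linear_map_add[OF \<phi>(1)] linear_map_smult[OF \<phi>(1)] head_carrier
          vectorspace_smult_closed[OF V])
    then show ?thesis
      using that bpos by (simp add: J_def coordinate_linear linear_map_closed[OF \<phi>(1)] head_carrier)
  qed
  obtain x l where l: "l \<in> {1..i}" "x l \<noteq> 0" and x: "\<And>j. j \<in> J \<Longrightarrow> \<phi> (head x) p j $ 0 = 0"
    using common_zero_of_few_functionals[OF \<open>finite J\<close> _ card, of "\<lambda>j x. \<phi> (head x) p j $ 0"] lin
    by auto
  have "jordan_chain p ?M k (\<lambda>j. \<phi> (chain_combination p k n e x j))"
    by (rule jordan_chain_morphism[OF rep \<phi>(1) \<psi> comm jordan_chain_chain_combination])
  from jordan_chain_regular_rep_head_eq_0[OF this \<open>0 < k\<close>] have "\<phi> (head x) = \<zero>\<^bsub>?U\<^esub>"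
    using x by (simp add: head_def J_def)
  then have "\<phi> (head x) = \<phi> \<zero>\<^bsub>?V\<^esub>"
    by (simp add: linear_map_zero[OF \<phi>(1)])
  then have "head x = \<zero>\<^bsub>?V\<^esub>"
    using inj_onD[OF \<phi>(2)] head_carrier vectorspace_l_zero[OF V] by blast
  then have "head x p l $ 0 = \<zero>\<^bsub>?V\<^esub> p l $ 0"
    by simp
  moreover have "k \<le> e p l" "0 < e p l" "l \<in> {1..n p}"
    using l(1) i edec[of l i] \<open>0 < k\<close> by (auto simp: k_def)
  ultimately show False
    using l(2)
    by (simp add: head_def chain_combination_def regular_rep_def kronecker_sum_def module_sum_def
        module_vec_simps)
qed

theorem theorem11:
  fixes m n :: "'k::alg_closed_field proj_line \<Rightarrow> nat"
    and b e :: "'k proj_line \<Rightarrow> nat \<Rightarrow> nat"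
  assumes "finite {p. m p \<noteq> 0}" and "finite {p. n p \<noteq> 0}"
    and "\<And>p i. 1 \<le> i \<Longrightarrow> i \<le> m p \<Longrightarrow> b p i > 0"
    and "\<And>p i. 1 \<le> i \<Longrightarrow> i \<le> n p \<Longrightarrow> e p i > 0"
    and "\<And>p i j. 1 \<le> i \<Longrightarrow> i \<le> j \<Longrightarrow> j \<le> m p \<Longrightarrow> b p i \<ge> b p j"
    and "\<And>p i j. 1 \<le> i \<Longrightarrow> i \<le> j \<Longrightarrow> j \<le> n p \<Longrightarrow> e p i \<ge> e p j"
  shows "subrep (regular_rep n e) (regular_rep m b) \<longleftrightarrow>
    (\<forall>p. m p \<ge> n p \<and> (\<forall>i. 1 \<le> i \<and> i \<le> n p \<longrightarrow> b p i \<ge> e p i))"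
proof
  assume sub: "subrep (regular_rep n e) (regular_rep m b)"
  have le: "i \<le> m p \<and> e p i \<le> b p i" if "1 \<le> i" "i \<le> n p" for p i
    using block_sizes_le_of_subrep[OF sub assms(3-6) that] .
  have "n p \<le> m p" for p
    using le[of "n p" p] by (cases "n p = 0") auto
  with le show "\<forall>p. m p \<ge> n p \<and> (\<forall>i. 1 \<le> i \<and> i \<le> n p \<longrightarrow> b p i \<ge> e p i)"
    by blast
next
  assume "\<forall>p. m p \<ge> n p \<and> (\<forall>i. 1 \<le> i \<and> i \<le> n p \<longrightarrow> b p i \<ge> e p i)"
  then show "subrep (regular_rep n e) (regular_rep m b)"
    by (intro subrep_regular_rep assms(1,2)) auto
qed

end
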